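(* Let $n\geq 1$, let $X_1,\ldots,X_n$ be exchangeable real-valued random variables defined on a common probability space, put $\boldsymbol{X}=(X_1,\ldots,X_n)$, and let $\boldsymbol{Y}=(Y_1,\ldots,Y_n)$ with $Y_1\leq\cdots\leq Y_n$ be the vector of order statistics of $\boldsymbol{X}$. If $g:\mathbb{R}^n\to\mathbb{R}$ is Borel measurable with $\mathbb{E}|g(\boldsymbol{X})|<\infty$, then \[ \mathbb{E}[g(\boldsymbol{X})\mid \boldsymbol{Y}]=\frac{1}{n!}\sum_{\boldsymbol{\pi}} g(Y_{\pi(1)},\ldots,Y_{\pi(n)})\quad\text{almost surely}, \] where the sum is taken over all $n!$ permutations $\boldsymbol{\pi}=(\pi(1),\ldots,\pi(n))$ of $\{1,\ldots,n\}$.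
   Context: Random variables $X_1,\ldots,X_n$ are exchangeable if for every permutation $\boldsymbol{\pi}$ of $\{1,\ldots,n\}$ the random vector $(X_{\pi(1)},\ldots,X_{\pi(n)})$ has the same distribution on $\mathbb{R}^n$ as $(X_1,\ldots,X_n)$. The order statistics $Y_1\leq\cdots\leq Y_n$ of $(X_1,\ldots,X_n)$ are the values $X_1,\ldots,X_n$ (counted with multiplicity) rearranged, pointwise on the probability space, in nondecreasing order. $\mathbb{E}[\,\cdot\mid\boldsymbol{Y}]$ denotes conditional expectation given the $\sigma$-field $\sigma(\boldsymbol{Y})$ generated by $\boldsymbol{Y}$. *)

theory Defs
  imports "HOL-Probability.Probability" "HOL-Combinatorics.Permutations"
begin

text \<open>
  Points of \<open>\<real>\<^sup>n\<close> are the extensional functions on \<open>{1..n}\<close>. For a finite index set the product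
  \<open>\<sigma>\<close>-algebra of the Borel sets of the line is the Borel \<open>\<sigma>\<close>-algebra of \<open>\<real>\<^sup>n\<close>.
\<close>

abbreviation borel_Rn :: "nat \<Rightarrow> (nat \<Rightarrow> real) measure" where
  "borel_Rn n \<equiv> PiM {1..n} (\<lambda>_. borel)"

definition random_vector :: "nat \<Rightarrow> (nat \<Rightarrow> 'a \<Rightarrow> real) \<Rightarrow> 'a \<Rightarrow> (nat \<Rightarrow> real)" where
  "random_vector n X = (\<lambda>\<omega>. \<lambda>i\<in>{1..n}. X i \<omega>)"

text \<open>
  The value of \<open>distr\<close> is the law of the vector only when its components are measurable, so this
  is to be used for random variables \<open>X 1, \<dots>, X n\<close> on a probability space \<open>M\<close>.
\<close>

definition exchangeable :: "'a measure \<Rightarrow> nat \<Rightarrow> (nat \<Rightarrow> 'a \<Rightarrow> real) \<Rightarrow> bool" where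
  "exchangeable M n X \<longleftrightarrow>
     (\<forall>\<pi>. \<pi> permutes {1..n} \<longrightarrow>
        distr M (borel_Rn n) (random_vector n (\<lambda>i. X (\<pi> i)))
          = distr M (borel_Rn n) (random_vector n X))"

text \<open>
  Lists are indexed from \<open>0\<close>, order statistics from \<open>1\<close>; the value is meaningful for \<open>i \<in> {1..n}\<close>.
\<close>

definition order_statistic :: "nat \<Rightarrow> (nat \<Rightarrow> 'a \<Rightarrow> real) \<Rightarrow> nat \<Rightarrow> 'a \<Rightarrow> real" where
  "order_statistic n X i \<omega> = sort (map (\<lambda>j. X j \<omega>) [1..<Suc n]) ! (i - 1)"

definition sigma_generated ::
    "'a measure \<Rightarrow> nat \<Rightarrow> (nat \<Rightarrow> 'a \<Rightarrow> real) \<Rightarrow> 'a measure" where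
  "sigma_generated M n Y = vimage_algebra (space M) (random_vector n Y) (borel_Rn n)"

end

theory Submission
  imports Defs
begin

text \<open>
  The order statistics form a permutation of the sample, so the right-hand side is the average of
  \<open>g\<close> over all rearrangements of \<open>\<^bold>X\<close> itself. On an event \<open>{\<^bold>Y \<in> B}\<close>, which is invariant under
  rearranging \<open>\<^bold>X\<close>, exchangeability gives every summand the same integral as \<open>g(\<^bold>X)\<close>.
\<close>

text \<open>In a sorted list the entries that are at most \<open>a\<close> form a prefix, so
  position \<open>k\<close> carries such an entry exactly when that prefix is longer than
  \<open>k\<close>.\<close>

lemma nth_le_iff_length_filter:
  fixes xs :: "'a::linorder list"
  assumes "sorted xs" and "k < length xs"
  shows "xs ! k \<le> a \<longleftrightarrow> k < length (filter (\<lambda>x. x \<le> a) xs)"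
  using assms
proof (induction xs arbitrary: k)
  case (Cons x xs)
  show ?case
  proof (cases k)
    case 0
    show ?thesis
    proof (cases "x \<le> a")
      case False
      then have "filter (\<lambda>x. x \<le> a) xs = []"
        using Cons.prems(1) by (fastforce simp: filter_empty_conv)
      then show ?thesis using 0 False by simp
    qed (use 0 in simp)
  next
    case (Suc j)
    have IH: "xs ! j \<le> a \<longleftrightarrow> j < length (filter (\<lambda>x. x \<le> a) xs)"
      using Cons Suc by simp
    show ?thesis
    proof (cases "x \<le> a")
      case False
      then have "filter (\<lambda>x. x \<le> a) xs = []"
        using Cons.prems(1) by (fastforce simp: filter_empty_conv)
      then show ?thesis using Suc IH False by simp
    qed (use Suc IH in simp)
  qed
qed simp

lemma length_filter_sort: "length (filter P (sort xs)) = length (filter P xs)"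
  by (metis mset_filter mset_sort size_mset)

lemma length_filter_map_upt:
  "length (filter P (map f [1..<Suc n])) = (\<Sum>j\<in>{1..n}. if P (f j) then 1 else 0)"
  by (induction n) auto

text \<open>Turns sorting into counting: the right-hand side is a finite sum of indicators of events
  in the single \<open>X j\<close>, which is visibly measurable in \<open>\<omega>\<close>.\<close>

lemma order_statistic_le_iff:
  assumes "k \<in> {1..n}"
  shows "order_statistic n X k \<omega> \<le> a \<longleftrightarrow> k \<le> (\<Sum>j\<in>{1..n}. if X j \<omega> \<le> a then 1 else 0)"
proof -
  let ?xs = "map (\<lambda>j. X j \<omega>) [1..<Suc n]"
  have "order_statistic n X k \<omega> \<le> a \<longleftrightarrow> k - 1 < length (filter (\<lambda>x. x \<le> a) (sort ?xs))"
    unfolding order_statistic_def by (rule nth_le_iff_length_filter) (use assms in auto)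
  also have "\<dots> \<longleftrightarrow> k - 1 < (\<Sum>j\<in>{1..n}. if X j \<omega> \<le> a then 1 else 0)"
    unfolding length_filter_sort length_filter_map_upt by (rule refl)
  \<comment> \<open>Since \<open>k\<close> is at least 1, the subtraction does not truncate, and
    \<open>k - 1 < m\<close> amounts to \<open>k \<le> m\<close>.\<close>
  finally show ?thesis using assms by auto
qed

lemma borel_measurable_order_statistic:
  assumes X: "\<And>i. i \<in> {1..n} \<Longrightarrow> X i \<in> borel_measurable M" and k: "k \<in> {1..n}"
  shows "order_statistic n X k \<in> borel_measurable M"
proof (rule borel_measurableI_le)
  fix a
  have [measurable]:
      "(\<lambda>\<omega>. \<Sum>j\<in>{1..n}. if X j \<omega> \<le> a then 1 else (0::nat)) \<in> measurable M (count_space UNIV)"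
  proof (rule measurable_sum_nat)
    fix j assume "j \<in> {1..n}"
    note [measurable] = X[OF this]
    show "(\<lambda>\<omega>. if X j \<omega> \<le> a then 1 else (0::nat)) \<in> measurable M (count_space UNIV)" by measurable
  qed
  show "{\<omega> \<in> space M. order_statistic n X k \<omega> \<le> a} \<in> sets M"
    unfolding order_statistic_le_iff[OF k] by measurable
qed

lemma measurable_random_vector:
  assumes "\<And>i. i \<in> {1..n} \<Longrightarrow> X i \<in> borel_measurable M"
  shows "random_vector n X \<in> measurable M (borel_Rn n)"
  unfolding random_vector_def using assms by (rule measurable_restrict)

lemma mset_map_permutes_upt:
  assumes "\<pi> permutes {1..n}"
  shows "mset (map (\<lambda>j. f (\<pi> j)) [1..<Suc n]) = mset (map f [1..<Suc n])"
proof -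
  have "mset (map (\<lambda>j. f (\<pi> j)) [1..<Suc n]) = image_mset f (image_mset \<pi> (mset_set {1..n}))"
    by (simp add: multiset.map_comp comp_def atLeastLessThanSuc_atLeastAtMost del: upt_Suc)
  also have "image_mset \<pi> (mset_set {1..n}) = mset_set {1..n}"
    using assms by (simp add: image_mset_mset_set permutes_inj_on permutes_image)
  finally show ?thesis
    by (simp add: atLeastLessThanSuc_atLeastAtMost del: upt_Suc)
qed

text \<open>Sorting depends only on the multiset of the entries, which a permutation of the indices
  preserves. This is what makes events about the order statistics invariant under rearranging the
  sample.\<close>

lemma order_statistic_permutes:
  assumes "\<pi> permutes {1..n}"
  shows "order_statistic n (\<lambda>i. X (\<pi> i)) = order_statistic n X"
proof (intro ext)
  fix i \<omega>
  show "order_statistic n (\<lambda>i. X (\<pi> i)) i \<omega> = order_statistic n X i \<omega>"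
    using arg_cong[where f = sorted_list_of_multiset, OF mset_map_permutes_upt[OF assms]]
    unfolding order_statistic_def sorted_list_of_multiset_mset by (rule arg_cong)
qed

text \<open>The sorting permutation is chosen for one fixed \<open>\<omega>\<close> and varies with
  it.\<close>

lemma order_statistic_eq_permutation:
  obtains \<sigma> where "\<sigma> permutes {1..n}"
    and "\<And>i. i \<in> {1..n} \<Longrightarrow> order_statistic n X i \<omega> = X (\<sigma> i) \<omega>"
proof -
  let ?xs = "map (\<lambda>j. X j \<omega>) [1..<Suc n]"
  have "mset (sort ?xs) = mset ?xs" by simp
  then obtain p where p: "p permutes {..<length ?xs}" "permute_list p ?xs = sort ?xs"
    by (rule mset_eq_permutation)
  have p': "p permutes {..<n}" using p(1) by (simp del: upt_Suc)
  \<comment> \<open>\<open>p\<close> acts on list positions, which start at 0;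
    \<open>\<sigma>\<close> is its conjugate by the shift to indices starting at 1, extended by the
    identity outside \<open>{1..n}\<close> as \<open>permutes\<close> demands.\<close>
  define \<sigma> where "\<sigma> i = (if i \<in> {1..n} then Suc (p (i - 1)) else i)" for i
  have lt: "p (i - 1) < n" if "i \<in> {1..n}" for i
    using permutes_in_image[OF p', of "i - 1"] that by auto
  have "inj_on \<sigma> {1..n}"
    by (rule inj_onI) (auto simp: \<sigma>_def dest!: injD[OF permutes_inj[OF p']])
  moreover have "\<sigma> ` {1..n} \<subseteq> {1..n}"
    using lt by (fastforce simp: \<sigma>_def)
  ultimately have "bij_betw \<sigma> {1..n} {1..n}"
    by (simp add: bij_betw_def endo_inj_surj)
  then have "\<sigma> permutes {1..n}"
    by (rule bij_imp_permutes) (simp only: \<sigma>_def if_False)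
  moreover have "order_statistic n X i \<omega> = X (\<sigma> i) \<omega>" if i: "i \<in> {1..n}" for i
  proof -
    have "order_statistic n X i \<omega> = permute_list p ?xs ! (i - 1)"
      unfolding order_statistic_def p(2) ..
    also have "\<dots> = ?xs ! p (i - 1)"
      by (rule permute_list_nth[OF p(1)]) (use i in auto)
    also have "\<dots> = X (\<sigma> i) \<omega>"
      using lt[OF i] i by (simp add: \<sigma>_def del: upt_Suc)
    finally show ?thesis .
  qed
  ultimately show ?thesis by (rule that)
qed

text \<open>At a fixed \<open>\<omega>\<close> the order statistics are the sample composed with
  some \<open>\<sigma>\<close>, and composing with \<open>\<sigma>\<close> on the left only
  reindexes the sum over the whole symmetric group. The dependence of \<open>\<sigma>\<close> on
  \<open>\<omega>\<close> thus disappears from the sum.\<close>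

lemma sum_permutations_order_statistic:
  "(\<Sum>\<pi> | \<pi> permutes {1..n}. g (random_vector n (\<lambda>i. order_statistic n X (\<pi> i)) \<omega>))
    = (\<Sum>\<pi> | \<pi> permutes {1..n}. g (random_vector n (\<lambda>i. X (\<pi> i)) \<omega>))"
proof -
  obtain \<sigma> where \<sigma>: "\<sigma> permutes {1..n}"
    "\<And>i. i \<in> {1..n} \<Longrightarrow> order_statistic n X i \<omega> = X (\<sigma> i) \<omega>"
    using order_statistic_eq_permutation[of n X \<omega>] by blast
  have "random_vector n (\<lambda>i. order_statistic n X (\<pi> i)) \<omega>
      = random_vector n (\<lambda>i. X ((\<sigma> \<circ> \<pi>) i)) \<omega>" if "\<pi> permutes {1..n}" for \<pi>
    unfolding random_vector_def
    by (rule restrict_ext) (use permutes_in_image[OF that] \<sigma>(2) in simp)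
  then have "(\<Sum>\<pi> | \<pi> permutes {1..n}. g (random_vector n (\<lambda>i. order_statistic n X (\<pi> i)) \<omega>))
      = (\<Sum>\<pi> | \<pi> permutes {1..n}. g (random_vector n (\<lambda>i. X ((\<sigma> \<circ> \<pi>) i)) \<omega>))"
    by (intro sum.cong) auto
  also have "\<dots> = (\<Sum>\<pi> | \<pi> permutes {1..n}. g (random_vector n (\<lambda>i. X (\<pi> i)) \<omega>))"
    by (rule setum_permutations_compose_left[OF \<sigma>(1), symmetric])
  finally show ?thesis .
qed

context
  fixes M :: "'a measure" and n :: nat and X :: "nat \<Rightarrow> 'a \<Rightarrow> real" and \<pi> :: "nat \<Rightarrow> nat"
  assumes X: "\<And>i. i \<in> {1..n} \<Longrightarrow> X i \<in> borel_measurable M"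
    and exch: "exchangeable M n X"
    and \<pi>: "\<pi> permutes {1..n}"
begin

lemma measurable_random_vector_permutes:
  "random_vector n (\<lambda>i. X (\<pi> i)) \<in> measurable M (borel_Rn n)"
  by (rule measurable_random_vector) (use X permutes_in_image[OF \<pi>] in blast)

text \<open>Both sides express integrability of \<open>f\<close> with respect to one and the same
  law on \<open>borel_Rn n\<close>, by change of variables.\<close>

lemma exchangeable_integrable_iff:
  fixes f :: "(nat \<Rightarrow> real) \<Rightarrow> real"
  assumes f: "f \<in> borel_measurable (borel_Rn n)"
  shows "integrable M (\<lambda>\<omega>. f (random_vector n (\<lambda>i. X (\<pi> i)) \<omega>))
    \<longleftrightarrow> integrable M (\<lambda>\<omega>. f (random_vector n X \<omega>))"
  using integrable_distr_eq[OF measurable_random_vector_permutes f]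
    integrable_distr_eq[OF measurable_random_vector[OF X] f] exch \<pi>
  unfolding exchangeable_def by auto

lemma exchangeable_integral_eq:
  fixes f :: "(nat \<Rightarrow> real) \<Rightarrow> real"
  assumes f: "f \<in> borel_measurable (borel_Rn n)"
  shows "(\<integral>\<omega>. f (random_vector n (\<lambda>i. X (\<pi> i)) \<omega>) \<partial>M) = (\<integral>\<omega>. f (random_vector n X \<omega>) \<partial>M)"
  using integral_distr[OF measurable_random_vector_permutes f]
    integral_distr[OF measurable_random_vector[OF X] f] exch \<pi>
  unfolding exchangeable_def by auto

end

text \<open>The order statistics are a fixed function of the vector, namely the sorting map on
  \<open>borel_Rn n\<close>, obtained by applying \<open>order_statistic\<close> to the coordinate
  projections \<open>\<lambda>i x. x i\<close>.\<close>

lemma random_vector_order_statistic: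
  "random_vector n (order_statistic n X) \<omega>
    = random_vector n (order_statistic n (\<lambda>i x. x i)) (random_vector n X \<omega>)"
proof -
  have "map (\<lambda>j. X j \<omega>) [1..<Suc n] = map (\<lambda>j. random_vector n X \<omega> j) [1..<Suc n]"
    by (rule map_cong) (auto simp: random_vector_def)
  then show ?thesis unfolding order_statistic_def random_vector_def by (simp only:)
qed

theorem theorem1:
  fixes M :: "'a measure" and n :: nat
    and X Y :: "nat \<Rightarrow> 'a \<Rightarrow> real" and g :: "(nat \<Rightarrow> real) \<Rightarrow> real"
  assumes "prob_space M"
    and "n \<ge> 1"
    and "\<And>i. i \<in> {1..n} \<Longrightarrow> X i \<in> borel_measurable M"
    and "exchangeable M n X"
    and "Y = order_statistic n X"
    and "g \<in> borel_measurable (borel_Rn n)"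
    and "integrable M (\<lambda>\<omega>. g (random_vector n X \<omega>))"
  shows "AE \<omega> in M.
    real_cond_exp M (sigma_generated M n Y) (\<lambda>\<omega>. g (random_vector n X \<omega>)) \<omega>
      = (1 / fact n) * (\<Sum>\<pi> | \<pi> permutes {1..n}. g (random_vector n (\<lambda>i. Y (\<pi> i)) \<omega>))"
proof -
  interpret prob_space M by fact
  note X = assms(3) and exch = assms(4) and Y = assms(5) and g = assms(6) and int = assms(7)
  let ?P = "{\<pi>. \<pi> permutes {1..n}}" and ?F = "sigma_generated M n Y"
  let ?f = "\<lambda>\<omega>. g (random_vector n X \<omega>)"
  let ?h = "\<lambda>\<omega>. (1 / fact n) * (\<Sum>\<pi>\<in>?P. g (random_vector n (\<lambda>i. Y (\<pi> i)) \<omega>))"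
  have card: "card ?P = fact n" by (rule card_permutations) auto
  have Yvec: "random_vector n Y \<in> measurable M (borel_Rn n)"
    unfolding Y using X by (intro measurable_random_vector borel_measurable_order_statistic)
  have sub: "subalgebra M ?F"
    using measurable_sets[OF Yvec] measurable_space[OF Yvec]
    by (auto simp: subalgebra_def sigma_generated_def sets_vimage_algebra2)
  \<comment> \<open>Finiteness makes the restriction of \<open>M\<close> to \<open>?F\<close>
    sigma-finite, the setting of \<open>real_cond_exp_charact\<close>.\<close>
  interpret finite_measure_subalgebra M ?F by unfold_locales (rule sub)
  \<comment> \<open>The form of \<open>?h\<close> in \<open>Y\<close> serves for measurability with
    respect to \<open>?F\<close>, the form in \<open>X\<close> for integrability and for the
    integrals, where exchangeability applies.\<close>
  have h_X: "?h \<omega> = (1 / fact n) * (\<Sum>\<pi>\<in>?P. g (random_vector n (\<lambda>i. X (\<pi> i)) \<omega>))" for \<omega>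
    unfolding Y sum_permutations_order_statistic ..
  have int_perm: "integrable M (\<lambda>\<omega>. g (random_vector n (\<lambda>i. X (\<pi> i)) \<omega>))" if "\<pi> \<in> ?P" for \<pi>
    using exchangeable_integrable_iff[OF X exch _ g, of \<pi>] int that by simp
  have "?h \<in> borel_measurable ?F"
  proof -
    have YF: "random_vector n Y \<in> measurable ?F (borel_Rn n)"
      unfolding sigma_generated_def
      by (rule measurable_vimage_algebra1) (use measurable_space[OF Yvec] in auto)
    have "(\<lambda>\<omega>. g (random_vector n (\<lambda>i. Y (\<pi> i)) \<omega>)) \<in> borel_measurable ?F" if "\<pi> \<in> ?P" for \<pi>
    proof -
      have "Y (\<pi> i) \<in> borel_measurable ?F" if i: "i \<in> {1..n}" for i
      proof -
        have *: "\<pi> i \<in> {1..n}" using permutes_in_image[of \<pi> "{1..n}" i] \<open>\<pi> \<in> ?P\<close> i by simp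
        have "(\<lambda>\<omega>. random_vector n Y \<omega> (\<pi> i)) \<in> borel_measurable ?F"
          by (rule measurable_compose[OF YF measurable_component_singleton[OF *]])
        then show ?thesis using * by (simp add: random_vector_def)
      qed
      then have "random_vector n (\<lambda>i. Y (\<pi> i)) \<in> measurable ?F (borel_Rn n)"
        by (rule measurable_random_vector)
      then show ?thesis using g by (rule measurable_compose)
    qed
    then show ?thesis by (intro borel_measurable_times borel_measurable_sum borel_measurable_const)
  qed
  moreover have "integrable M ?h"
    unfolding h_X by (intro integrable_mult_right Bochner_Integration.integrable_sum int_perm)
  moreover have "(\<integral>\<omega>\<in>A. ?f \<omega> \<partial>M) = (\<integral>\<omega>\<in>A. ?h \<omega> \<partial>M)" if A: "A \<in> sets ?F" for A
  proof -
    obtain B where B: "B \<in> sets (borel_Rn n)" "A = random_vector n Y -` B \<inter> space M"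
      using A measurable_space[OF Yvec] by (auto simp: sigma_generated_def sets_vimage_algebra2)
    \<comment> \<open>\<open>T\<close> is the sorting map, so \<open>A\<close> is the event that
      \<open>T\<close> sends the sample into \<open>B\<close>.\<close>
    define T :: "(nat \<Rightarrow> real) \<Rightarrow> (nat \<Rightarrow> real)"
      where "T = random_vector n (order_statistic n (\<lambda>i x. x i))"
    have [measurable]: "T \<in> measurable (borel_Rn n) (borel_Rn n)"
      unfolding T_def
      by (intro measurable_random_vector borel_measurable_order_statistic
          measurable_component_singleton)
    \<comment> \<open>Absorbing the indicator of \<open>A\<close> into the integrand leaves a single
      function of the sample vector, to which equality of laws can be applied.\<close>
    define F where "F x = indicator B (T x) * g x" for x
    note [measurable] = B(1) g
    have F: "F \<in> borel_measurable (borel_Rn n)" unfolding F_def by measurable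
    \<comment> \<open>Sorting the rearranged sample gives the same order statistics, so the same
      event \<open>A\<close> appears for every \<open>\<pi>\<close>.\<close>
    have ind: "indicator A \<omega> * g (random_vector n (\<lambda>i. X (\<pi> i)) \<omega>)
        = F (random_vector n (\<lambda>i. X (\<pi> i)) \<omega>)" if "\<pi> \<in> ?P" "\<omega> \<in> space M" for \<pi> \<omega>
    proof -
      have "T (random_vector n (\<lambda>i. X (\<pi> i)) \<omega>) = random_vector n Y \<omega>"
        using that(1) unfolding T_def Y
        by (simp flip: random_vector_order_statistic add: order_statistic_permutes)
      then show ?thesis using that(2) by (simp add: F_def B(2) indicator_def)
    qed
    have A_M: "A \<in> sets M" using A sub by (auto simp: subalgebra_def)
    have int_A: "integrable M (\<lambda>\<omega>. indicator A \<omega> * g (random_vector n (\<lambda>i. X (\<pi> i)) \<omega>))"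
      if "\<pi> \<in> ?P" for \<pi>
      using integrable_mult_indicator[OF A_M int_perm[OF that]] by simp
    have same: "(\<integral>\<omega>. indicator A \<omega> * g (random_vector n (\<lambda>i. X (\<pi> i)) \<omega>) \<partial>M)
        = (\<integral>\<omega>. F (random_vector n X \<omega>) \<partial>M)" if "\<pi> \<in> ?P" for \<pi>
    proof -
      have "(\<integral>\<omega>. indicator A \<omega> * g (random_vector n (\<lambda>i. X (\<pi> i)) \<omega>) \<partial>M)
          = (\<integral>\<omega>. F (random_vector n (\<lambda>i. X (\<pi> i)) \<omega>) \<partial>M)"
        by (rule Bochner_Integration.integral_cong) (use ind that in auto)
      then show ?thesis using exchangeable_integral_eq[OF X exch _ F] that by simp
    qed
    have "(\<integral>\<omega>\<in>A. ?h \<omega> \<partial>M) = (\<integral>\<omega>. (1 / fact n) *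
        (\<Sum>\<pi>\<in>?P. indicator A \<omega> * g (random_vector n (\<lambda>i. X (\<pi> i)) \<omega>)) \<partial>M)"
      unfolding set_lebesgue_integral_def h_X
      by (simp add: sum_distrib_left mult.left_commute)
    also have "\<dots> = (1 / fact n) *
        (\<Sum>\<pi>\<in>?P. \<integral>\<omega>. indicator A \<omega> * g (random_vector n (\<lambda>i. X (\<pi> i)) \<omega>) \<partial>M)"
      using int_A by (subst integral_mult_right_zero, subst Bochner_Integration.integral_sum) auto
    \<comment> \<open>By \<open>same\<close> all \<open>fact n\<close> summands agree, and their
      number cancels the factor in front.\<close>
    also have "\<dots> = (\<integral>\<omega>. F (random_vector n X \<omega>) \<partial>M)"
      using same card by simp
    \<comment> \<open>The identity permutation is the summand belonging to \<open>?f\<close>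
      itself.\<close>
    also have "\<dots> = (\<integral>\<omega>\<in>A. ?f \<omega> \<partial>M)"
      using same[of id] by (simp add: permutes_id set_lebesgue_integral_def)
    finally show ?thesis ..
  qed
  \<comment> \<open>An integrable \<open>?F\<close>-measurable function with the same integrals as
    \<open>?f\<close> over all sets of \<open>?F\<close> is a version of the conditional
    expectation.\<close>
  ultimately show ?thesis using real_cond_exp_charact[of ?f ?h] int by blast
qed

end
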